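(* Let $k \ge 0$ be an integer and let $G$ be a graph on $n$ vertices and $e(G)$ edges. Then: (i) $e(G) \le \frac{1}{2} \left( n^2 - \frac{n^2}{\varphi_k(G)} + nk \right)$; (ii) $e(G) \ge \frac{1}{2} \left( \frac{n^2}{\Omega_k(G)} - n(k+1) \right)$.
   Context: Graphs are finite and simple with nonempty vertex set; $n = |V(G)|$. For an integer $k \ge 0$: a set $A \subseteq V(G)$ is $k$-small if $\deg(v) \le n - |A| + k$ for every $v \in A$; a set $B \subseteq V(G)$ is $k$-large if $\deg(v) \ge |B| - k - 1$ for every $v \in B$. $\varphi_k(G)$ (resp. $\Omega_k(G)$) is the minimum integer $t$ such that $V(G)$ can be partitioned into $t$ $k$-small (resp. $k$-large) sets. *)

theory Defs
  imports Complex_Main "HOL-Library.Disjoint_Sets" "Graph_Theory.Digraph"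
begin

text \<open>
  The locale \<^locale>\<open>graph\<close> models a finite simple graph as a loopfree symmetric digraph without
  parallel arcs, so an edge $uv$ is represented by the two arcs $(u,v)$ and $(v,u)$. Degrees and
  the number of edges refer to the undirected edges, i.e. two-element sets of vertices.
  \<^locale>\<open>graph\<close> admits the null graph, so nonemptiness of the vertex set is assumed separately.
\<close>

definition edges :: "('a, 'b) pre_digraph \<Rightarrow> 'a set set" where
  "edges G = (\<lambda>a. {tail G a, head G a}) ` arcs G"

definition deg :: "('a, 'b) pre_digraph \<Rightarrow> 'a \<Rightarrow> nat" where
  "deg G v = card {e \<in> edges G. v \<in> e}"

text \<open>The inequalities are over the integers, since natural number subtraction truncates.\<close>

definition k_small :: "nat \<Rightarrow> ('a, 'b) pre_digraph \<Rightarrow> 'a set \<Rightarrow> bool" where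
  "k_small k G A \<longleftrightarrow> A \<subseteq> verts G \<and>
    (\<forall>v\<in>A. int (deg G v) \<le> int (card (verts G)) - int (card A) + int k)"

definition k_large :: "nat \<Rightarrow> ('a, 'b) pre_digraph \<Rightarrow> 'a set \<Rightarrow> bool" where
  "k_large k G B \<longleftrightarrow> B \<subseteq> verts G \<and>
    (\<forall>v\<in>B. int (deg G v) \<ge> int (card B) - int k - 1)"

text \<open>
  The parts of \<^const>\<open>partition_on\<close> are nonempty; allowing empty parts would not change the minima.
  The minima exist for finite simple graphs, because singletons are both $k$-small and $k$-large.
\<close>

definition phi :: "nat \<Rightarrow> ('a, 'b) pre_digraph \<Rightarrow> nat" where
  "phi k G = (LEAST t. \<exists>P. partition_on (verts G) P \<and> card P = t \<and> (\<forall>A\<in>P. k_small k G A))"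

definition Omega :: "nat \<Rightarrow> ('a, 'b) pre_digraph \<Rightarrow> nat" where
  "Omega k G = (LEAST t. \<exists>P. partition_on (verts G) P \<and> card P = t \<and> (\<forall>B\<in>P. k_large k G B))"

lemma (in graph) deg_less_card_verts:
  assumes "v \<in> verts G"
  shows "deg G v < card (verts G)"
proof -
  have "{e \<in> edges G. v \<in> e} \<subseteq> (\<lambda>w. {v, w}) ` (verts G - {v})"
    using no_loops by (force simp: edges_def image_iff)
  then have "deg G v \<le> card (verts G - {v})"
    unfolding deg_def by (meson finite_Diff finite_verts surj_card_le)
  also have "\<dots> < card (verts G)"
    using assms by (meson card_Diff1_less finite_verts)
  finally show ?thesis .
qed

lemma (in graph) ex_k_small_partition:
  "\<exists>P. partition_on (verts G) P \<and> (\<forall>A\<in>P. k_small k G A)"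
proof (intro exI conjI ballI)
  show "partition_on (verts G) ((\<lambda>v. {v}) ` verts G)"
    by (auto simp: partition_on_def disjoint_def)
  show "k_small k G A" if "A \<in> (\<lambda>v. {v}) ` verts G" for A
    using that deg_less_card_verts by (force simp: k_small_def)
qed

lemma (in graph) ex_k_large_partition:
  "\<exists>P. partition_on (verts G) P \<and> (\<forall>B\<in>P. k_large k G B)"
proof (intro exI conjI ballI)
  show "partition_on (verts G) ((\<lambda>v. {v}) ` verts G)"
    by (auto simp: partition_on_def disjoint_def)
  show "k_large k G B" if "B \<in> (\<lambda>v. {v}) ` verts G" for B
    using that by (auto simp: k_large_def)
qed

end

theory Submission
  imports Defs "HOL-Analysis.Convex"
begin

text \<open>
  By the handshake lemma \<open>2 e(G)\<close> is the sum of all degrees. Summing the degree bound over the parts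
  of a minimum partition into \<open>k\<close>-small sets gives at most \<open>n\<^sup>2 - \<Sum>|A|\<^sup>2 + nk\<close>, for \<open>k\<close>-large sets at
  least \<open>\<Sum>|B|\<^sup>2 - n(k+1)\<close>, and \<open>\<Sum>|A|\<^sup>2 \<ge> n\<^sup>2/t\<close> for \<open>t\<close> parts by Cauchy-Schwarz.
\<close>

lemma (in graph) finite_edges: "finite (edges G)"
  by (simp add: edges_def)

text \<open>Double counting of the incident pairs of a vertex and an edge: since loops are excluded,
  every edge has exactly two distinct endpoints.\<close>

lemma (in graph) sum_deg_eq_twice_card_edges:
  "(\<Sum>v\<in>verts G. deg G v) = 2 * card (edges G)"
  unfolding deg_def
proof (rule sum_multicount)
  show "\<forall>e\<in>edges G. card {v \<in> verts G. v \<in> e} = 2"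
  proof
    fix e assume "e \<in> edges G"
    then obtain a where a: "a \<in> arcs G" "e = {tail G a, head G a}"
      by (auto simp: edges_def)
    then have "{v \<in> verts G. v \<in> e} = {tail G a, head G a}"
      by auto
    then show "card {v \<in> verts G. v \<in> e} = 2"
      using a(1) no_loops by simp
  qed
qed (simp_all add: finite_edges)

lemma card_eq_sum_card_partition_on:
  assumes "finite V" "partition_on V P"
  shows "real (card V) = (\<Sum>A\<in>P. real (card A))"
  using sum.partition[OF assms, of "\<lambda>_. 1 :: real"] by simp

text \<open>Cauchy-Schwarz applied to the block sizes, which add up to
  \<open>card V\<close>.\<close>

lemma sum_card_power2_partition_on_ge:
  assumes "finite V" "partition_on V P"
  shows "(real (card V))\<^sup>2 / real (card P) \<le> (\<Sum>A\<in>P. (real (card A))\<^sup>2)"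
proof (cases "card P = 0")
  \<comment> \<open>Division by zero yields 0, so the left side vanishes.\<close>
  case True
  then show ?thesis by (simp add: sum_nonneg)
next
  case False
  have "real (card V) = (\<Sum>A\<in>P. real (card A))"
    by (rule card_eq_sum_card_partition_on[OF assms])
  then have "(real (card V))\<^sup>2 \<le> real (card P) * (\<Sum>A\<in>P. (real (card A))\<^sup>2)"
    using sum_squared_le_sum_of_squares[of "\<lambda>A. real (card A)" P] by (simp add: mult.commute)
  then show ?thesis
    using False by (simp add: divide_le_eq mult.commute)
qed

text \<open>The bound weakens as the number of parts grows, so a minimum partition gives its
  sharpest instance.\<close>

lemma (in graph) card_edges_le_of_k_small_partition:
  assumes P: "partition_on (verts G) P" "\<And>A. A \<in> P \<Longrightarrow> k_small k G A"
  defines "n \<equiv> real (card (verts G))"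
  shows "2 * real (card (edges G)) \<le> n\<^sup>2 - n\<^sup>2 / real (card P) + n * real k"
proof -
  have sum_card: "n = (\<Sum>A\<in>P. real (card A))"
    unfolding n_def by (rule card_eq_sum_card_partition_on[OF finite_verts P(1)])
  have "2 * real (card (edges G)) = (\<Sum>v\<in>verts G. real (deg G v))"
    using arg_cong[OF sum_deg_eq_twice_card_edges, of real] by simp
  also have "\<dots> = (\<Sum>A\<in>P. \<Sum>v\<in>A. real (deg G v))"
    by (rule sum.partition[OF finite_verts P(1)])
  also have "\<dots> \<le> (\<Sum>A\<in>P. real (card A) * (n - real (card A) + real k))"
  \<comment> \<open>The degree bound is constant on a block \<open>A\<close>, so summing over
    \<open>A\<close> multiplies it by \<open>card A\<close>.\<close>
  proof (intro sum_mono sum_bounded_above)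
    fix A v assume "A \<in> P" "v \<in> A"
    then have "int (deg G v) \<le> int (card (verts G)) - int (card A) + int k"
      using P(2) by (simp add: k_small_def)
    then show "real (deg G v) \<le> n - real (card A) + real k"
      by (simp add: n_def)
  qed
  also have "\<dots> = n * (n + real k) - (\<Sum>A\<in>P. (real (card A))\<^sup>2)"
    \<comment> \<open>The block sizes add up to \<open>n\<close>, so the terms linear in
      \<open>card A\<close> collect to \<open>n * (n + k)\<close> and only the squares
      remain.\<close>
    using arg_cong[OF sum_card, of "\<lambda>x. x * (n + real k)"]
    by (simp add: sum_distrib_left sum_subtractf sum.distrib algebra_simps power2_eq_square)
  also have "\<dots> \<le> n\<^sup>2 - n\<^sup>2 / real (card P) + n * real k"
    using sum_card_power2_partition_on_ge[OF finite_verts P(1)]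
    by (simp add: n_def algebra_simps power2_eq_square)
  finally show ?thesis .
qed

lemma (in graph) card_edges_ge_of_k_large_partition:
  assumes P: "partition_on (verts G) P" "\<And>B. B \<in> P \<Longrightarrow> k_large k G B"
  defines "n \<equiv> real (card (verts G))"
  shows "2 * real (card (edges G)) \<ge> n\<^sup>2 / real (card P) - n * (real k + 1)"
proof -
  have sum_card: "n = (\<Sum>B\<in>P. real (card B))"
    unfolding n_def by (rule card_eq_sum_card_partition_on[OF finite_verts P(1)])
  have "n\<^sup>2 / real (card P) - n * (real k + 1) \<le> (\<Sum>B\<in>P. (real (card B))\<^sup>2) - n * (real k + 1)"
    using sum_card_power2_partition_on_ge[OF finite_verts P(1)] by (simp add: n_def)
  also have "\<dots> = (\<Sum>B\<in>P. real (card B) * (real (card B) - real k - 1))"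
    \<comment> \<open>Writing \<open>n\<close> as the sum of the block sizes merges both terms into
      one sum, which is then compared block by block.\<close>
    unfolding sum_card sum_distrib_right sum_subtractf[symmetric]
    by (simp add: algebra_simps power2_eq_square)
  also have "\<dots> \<le> (\<Sum>B\<in>P. \<Sum>v\<in>B. real (deg G v))"
  proof (intro sum_mono sum_bounded_below)
    fix B v assume "B \<in> P" "v \<in> B"
    then have "int (card B) - int k - 1 \<le> int (deg G v)"
      using P(2) by (simp add: k_large_def)
    then show "real (card B) - real k - 1 \<le> real (deg G v)"
      by linarith
  qed
  also have "\<dots> = (\<Sum>v\<in>verts G. real (deg G v))"
    by (rule sum.partition[OF finite_verts P(1), symmetric])
  also have "\<dots> = 2 * real (card (edges G))"
    using arg_cong[OF sum_deg_eq_twice_card_edges, of real] by simp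
  finally show ?thesis .
qed

text \<open>The \<open>LEAST\<close> in \<open>phi\<close> is attained because some partition into
  \<open>k\<close>-small sets exists, for instance the one into singletons.\<close>

lemma (in graph) obtain_phi_partition:
  obtains P where "partition_on (verts G) P" "card P = phi k G" "\<And>A. A \<in> P \<Longrightarrow> k_small k G A"
proof -
  have "\<exists>t P. partition_on (verts G) P \<and> card P = t \<and> (\<forall>A\<in>P. k_small k G A)"
    using ex_k_small_partition by blast
  from LeastI_ex[OF this] show thesis
    using that unfolding phi_def by blast
qed

lemma (in graph) obtain_Omega_partition:
  obtains P where "partition_on (verts G) P" "card P = Omega k G" "\<And>B. B \<in> P \<Longrightarrow> k_large k G B"
proof -
  have "\<exists>t P. partition_on (verts G) P \<and> card P = t \<and> (\<forall>B\<in>P. k_large k G B)"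
    using ex_k_large_partition by blast
  from LeastI_ex[OF this] show thesis
    using that unfolding Omega_def by blast
qed

theorem corollary4p3:
  fixes G :: "('a, 'b) pre_digraph" and k n :: nat
  assumes "graph G" and "verts G \<noteq> {}" and "n = card (verts G)"
  shows "real (card (edges G)) \<le> 1 / 2 * (real n ^ 2 - real n ^ 2 / real (phi k G) + real n * real k)
    \<and> real (card (edges G)) \<ge> 1 / 2 * (real n ^ 2 / real (Omega k G) - real n * (real k + 1))"
proof -
  interpret graph G by fact
  obtain P where P: "partition_on (verts G) P" "card P = phi k G" "\<And>A. A \<in> P \<Longrightarrow> k_small k G A"
    using obtain_phi_partition by blast
  obtain Q where Q: "partition_on (verts G) Q" "card Q = Omega k G" "\<And>B. B \<in> Q \<Longrightarrow> k_large k G B"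
    using obtain_Omega_partition by blast
  show ?thesis
    using card_edges_le_of_k_small_partition[OF P(1,3)] card_edges_ge_of_k_large_partition[OF Q(1,3)]
    by (simp add: P(2) Q(2) assms(3))
qed

end
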